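(* Let $\mathcal A:\mathbb R^n\to\mathcal S(p)$ be a matrix function such that for all $x,y\in\mathbb R^n$ and all $\lambda\in[0,1]$, $$\mathcal A(\lambda x+(1-\lambda)y)-\lambda\mathcal A(x)-(1-\lambda)\mathcal A(y)\in\mathcal{COP}^p.$$ Let $X=\{x\in\mathbb R^n:\mathcal A(x)\in\mathcal{COP}^p\}$ and $\mathcal D=\{\mathcal A(x):x\in X\}$, so that $T_0(\mathcal D)=\{t\in T:t^\top\mathcal A(x)t=0\ \forall x\in X\}$. Suppose $T_0(\mathcal D)\ne\emptyset$ and let $\mathcal V=\{t(i)\in T_0(\mathcal D),\ i\in\mathcal I\}$, $0<|\mathcal I|<\infty$, be any nonempty finite subset of $T_0(\mathcal D)$. Then $X=\mathcal X(\mathcal V)$, where $$\mathcal X(\mathcal V)=\{x\in\mathbb R^n:\ \mathcal A(x)t(i)\ge0\ \ \forall i\in\mathcal I;\ \ t^\top\mathcal A(x)t\ge0\ \ \forall t\in\Omega(\mathcal V)\}$$ (the inequality $\mathcal A(x)t(i)\ge 0$ being componentwise).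
   Context: Let $p>1$ be an integer, $P=\{1,\dots,p\}$, $\mathcal S(p)$ the space of real symmetric $p\times p$ matrices, $\mathcal{COP}^p=\{D\in\mathcal S(p): t^\top Dt\ge 0\ \forall t\in\mathbb R^p_+\}$ the cone of copositive matrices, and $T=\{t\in\mathbb R^p_+: \sum_{k\in P}t_k=1\}$. For $t\in\mathbb R^p_+$, $P_+(t)=\{k\in P:t_k>0\}$. For $Q\subset\mathcal{COP}^p$, $T_0(Q)=\{t\in T: t^\top Dt=0\ \forall D\in Q\}$. For a nonempty finite set $V=\{t(i),i\in I\}\subset T$ put $\sigma(V)=\min\{t_k(i): k\in P_+(t(i)),\ i\in I\}$ and $\Omega(V)=\{t\in T:\rho(t,\mathrm{conv}\,V)\ge\sigma(V)\}$, where $\rho(l,\mathcal B)=\min_{\tau\in\mathcal B}\sum_{k\in P}|l_k-\tau_k|$ is the $\ell_1$-distance and $\mathrm{conv}$ denotes convex hull. $X$ is the feasible set of a convex copositive problem with constraint $\mathcal A(x)\in\mathcal{COP}^p$. *)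

theory Defs
  imports "HOL-Analysis.Analysis"
begin

text \<open>The index set \<open>P = {1, ..., p}\<close> is the finite type \<open>'p\<close>.\<close>

definition sym_matrices :: "(real ^ 'p ^ 'p) set" where
  "sym_matrices = {D. transpose D = D}"

definition nonneg_orthant :: "(real ^ 'p) set" where
  "nonneg_orthant = {t. \<forall>k. 0 \<le> t $ k}"

definition copositive_cone :: "(real ^ 'p ^ 'p) set" where
  "copositive_cone = {D \<in> sym_matrices. \<forall>t \<in> nonneg_orthant. 0 \<le> t \<bullet> (D *v t)}"

definition std_simplex :: "(real ^ 'p) set" where
  "std_simplex = {t \<in> nonneg_orthant. (\<Sum>k\<in>UNIV. t $ k) = 1}"

definition pos_support :: "real ^ 'p \<Rightarrow> 'p set" where
  "pos_support t = {k. 0 < t $ k}"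

definition common_zeros :: "(real ^ 'p ^ 'p) set \<Rightarrow> (real ^ 'p) set" where
  "common_zeros Q = {t \<in> std_simplex. \<forall>D \<in> Q. t \<bullet> (D *v t) = 0}"

definition min_pos_entry :: "(real ^ 'p) set \<Rightarrow> real" where
  "min_pos_entry V = Min {v $ k | v k. v \<in> V \<and> k \<in> pos_support v}"

text \<open>The infimum is attained for nonempty compact \<open>B\<close>, in particular for the convex hull of a
  nonempty finite set. The standard distance on \<open>real ^ 'p\<close> is Euclidean, hence the explicit
  sum.\<close>

definition l1_dist_set :: "real ^ 'p \<Rightarrow> (real ^ 'p) set \<Rightarrow> real" where
  "l1_dist_set l B = (INF \<tau>\<in>B. \<Sum>k\<in>UNIV. \<bar>l $ k - \<tau> $ k\<bar>)"

definition Omega_set :: "(real ^ 'p) set \<Rightarrow> (real ^ 'p) set" where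
  "Omega_set V = {t \<in> std_simplex. min_pos_entry V \<le> l1_dist_set t (convex hull V)}"

definition cop_convex :: "(real ^ 'n \<Rightarrow> real ^ 'p ^ 'p) \<Rightarrow> bool" where
  "cop_convex A \<longleftrightarrow> (\<forall>x y. \<forall>c\<in>{0..1}.
     A (c *\<^sub>R x + (1 - c) *\<^sub>R y) - c *\<^sub>R A x - (1 - c) *\<^sub>R A y \<in> copositive_cone)"

definition feasible_set :: "(real ^ 'n \<Rightarrow> real ^ 'p ^ 'p) \<Rightarrow> (real ^ 'n) set" where
  "feasible_set A = {x. A x \<in> copositive_cone}"

definition reduced_set ::
    "(real ^ 'n \<Rightarrow> real ^ 'p ^ 'p) \<Rightarrow> 'i set \<Rightarrow> ('i \<Rightarrow> real ^ 'p) \<Rightarrow> (real ^ 'n) set" where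
  "reduced_set A I \<tau> = {x. (\<forall>i\<in>I. A x *v \<tau> i \<in> nonneg_orthant) \<and>
     (\<forall>t \<in> Omega_set (\<tau> ` I). 0 \<le> t \<bullet> (A x *v t))}"

end

theory Submission imports Defs begin

text \<open>The nontrivial inclusion holds for each matrix \<open>D = A x\<close> separately. Suppose that
  \<open>D v \<ge> 0\<close> for all \<open>v \<in> V\<close>. A point \<open>t\<close> of the simplex outside \<open>\<Omega>(V)\<close> has positive entries
  on the whole support of some \<open>v \<in> V\<close>: otherwise each \<open>v\<close>, hence each point of \<open>conv V\<close>, would
  have mass at least \<open>\<sigma>(V)\<close> outside the support of \<open>t\<close>. Subtracting from \<open>t\<close> the largest
  multiple of \<open>v\<close> that keeps it nonnegative shrinks the support and does not increase the
  quadratic form of \<open>D\<close>, so induction on the size of the support gives copositivity.\<close>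

lemma sym_matrices_inner_commute:
  assumes "D \<in> sym_matrices"
  shows "u \<bullet> (D *v v) = v \<bullet> (D *v u)"
proof -
  have "transpose D = D"
    using assms by (simp add: sym_matrices_def)
  then show ?thesis
    by (metis dot_lmul_matrix transpose_matrix_vector inner_commute)
qed

lemma sym_matrices_quadratic_form_add:
  assumes "D \<in> sym_matrices"
  shows "(u + c *\<^sub>R w) \<bullet> (D *v (u + c *\<^sub>R w))
    = u \<bullet> (D *v u) + 2 * c * (w \<bullet> (D *v u)) + c\<^sup>2 * (w \<bullet> (D *v w))"
  using sym_matrices_inner_commute[OF assms, of u w]
  by (simp add: matrix_vector_right_distrib
      matrix_vector_mult_scaleR inner_add_left inner_add_right power2_eq_square algebra_simps)

text \<open>First-order optimality: \<open>v\<close> minimizes the quadratic form of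
  \<open>D\<close> over the orthant, and moving along any axis \<open>k\<close> stays inside it, so
  the directional derivative \<open>2 * (D *v v) $ k\<close> cannot be negative.\<close>

lemma copositive_zero_image_nonneg:
  assumes D: "D \<in> copositive_cone" and v: "v \<in> nonneg_orthant"
    and zero: "v \<bullet> (D *v v) = 0"
  shows "D *v v \<in> nonneg_orthant"
proof (rule ccontr)
  assume "D *v v \<notin> nonneg_orthant"
  then obtain k where k: "(D *v v) $ k < 0"
    by (auto simp: nonneg_orthant_def not_le)
  define a where "a = (D *v v) $ k"
  define e :: "real ^ 'a" where "e = axis k 1"
  define d where "d = e \<bullet> (D *v e)"
  \<comment> \<open>The step length must be short enough for the negative linear term to win:
    \<open>c * d \<le> - a\<close> gives \<open>2 * a + c * d \<le> a < 0\<close>. Dividing by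
    \<open>d + 1\<close> instead of \<open>d\<close> also covers \<open>d = 0\<close>.\<close>
  define c where "c = - a / (d + 1)"
  have e: "e \<in> nonneg_orthant"
    by (auto simp: e_def nonneg_orthant_def axis_def)
  then have d: "d \<ge> 0"
    using D by (auto simp: d_def copositive_cone_def)
  have c: "c > 0"
    using k d by (simp add: a_def c_def divide_neg_pos)
  have "v + c *\<^sub>R e \<in> nonneg_orthant"
    using v e c by (auto simp: nonneg_orthant_def)
  then have "0 \<le> (v + c *\<^sub>R e) \<bullet> (D *v (v + c *\<^sub>R e))"
    using D by (auto simp: copositive_cone_def)
  also have "\<dots> = c * (2 * a + c * d)"
    using sym_matrices_quadratic_form_add[of D v c e] D zero
    by (simp add: copositive_cone_def d_def a_def e_def inner_axis' power2_eq_square algebra_simps)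
  finally have "2 * a + c * d \<ge> 0"
    using c by (simp add: zero_le_mult_iff)
  moreover have "c * d \<le> - a"
    using d k by (simp add: c_def a_def field_simps)
  ultimately show False
    using k by (simp add: a_def)
qed

lemma finite_pos_entries:
  fixes V :: "(real ^ 'p) set"
  assumes "finite V"
  shows "finite {v $ k | v k. v \<in> V \<and> k \<in> pos_support v}"
proof (rule finite_subset)
  show "{v $ k | v k. v \<in> V \<and> k \<in> pos_support v} \<subseteq> (\<lambda>(v, k). v $ k) ` (V \<times> UNIV)"
    by auto
qed (use assms in simp)

lemma min_pos_entry_le:
  assumes "finite V" "v \<in> V" "k \<in> pos_support v"
  shows "min_pos_entry V \<le> v $ k"
  unfolding min_pos_entry_def
  using assms finite_pos_entries by (intro Min_le) auto

lemma pos_support_subset_of_notin_Omega: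
  fixes V :: "(real ^ 'p) set"
  assumes V: "finite V" "V \<noteq> {}" "V \<subseteq> nonneg_orthant"
    and t: "t \<in> std_simplex" "t \<notin> Omega_set V"
  obtains v where "v \<in> V" "pos_support v \<subseteq> pos_support t"
proof (rule ccontr)
  assume contra: "\<not> thesis"
  define N where "N = - pos_support t"
  have zero: "t $ k = 0" if "k \<in> N" for k
    using t that by (auto simp: N_def pos_support_def std_simplex_def nonneg_orthant_def not_less
        intro: antisym)
  \<comment> \<open>Having mass at least \<open>min_pos_entry V\<close> on \<open>N\<close> is a
    half-space condition, with the indicator vector of \<open>N\<close> as normal, so it passes from
    the points of \<open>V\<close> to their convex hull.\<close>
  define H where "H = {y :: real ^ 'p. min_pos_entry V \<le> (\<Sum>k\<in>N. y $ k)}"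
  have "H = {y. (\<chi> k. if k \<in> N then 1 else 0) \<bullet> y \<ge> min_pos_entry V}"
    by (simp add: H_def inner_vec_def if_distrib if_distribR sum.If_cases cong: if_cong)
  then have "convex H"
    by (simp add: convex_halfspace_ge)
  moreover have "V \<subseteq> H"
  proof
    fix v assume v: "v \<in> V"
    then have "\<not> pos_support v \<subseteq> pos_support t"
      using contra that by blast
    then obtain k where k: "k \<in> pos_support v" "k \<in> N"
      by (auto simp: N_def)
    have "min_pos_entry V \<le> v $ k"
      using V v k by (intro min_pos_entry_le)
    also have "\<dots> \<le> (\<Sum>k\<in>N. v $ k)"
      using V v k by (intro member_le_sum) (auto simp: nonneg_orthant_def)
    finally show "v \<in> H"
      by (simp add: H_def)
  qed
  ultimately have hull: "convex hull V \<subseteq> H"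
    by (intro hull_minimal)
  have "min_pos_entry V \<le> l1_dist_set t (convex hull V)"
    unfolding l1_dist_set_def
  proof (rule cINF_greatest)
    show "convex hull V \<noteq> {}"
      using V by simp
    fix y assume "y \<in> convex hull V"
    then have "min_pos_entry V \<le> (\<Sum>k\<in>N. y $ k)"
      using hull by (auto simp: H_def)
    \<comment> \<open>Since \<open>t\<close> vanishes on \<open>N\<close>, the mass of
      \<open>y\<close> there counts fully towards the distance.\<close>
    also have "\<dots> \<le> (\<Sum>k\<in>N. \<bar>t $ k - y $ k\<bar>)"
      by (intro sum_mono) (simp add: zero)
    also have "\<dots> \<le> (\<Sum>k\<in>UNIV. \<bar>t $ k - y $ k\<bar>)"
      by (intro sum_mono2) auto
    finally show "min_pos_entry V \<le> (\<Sum>k\<in>UNIV. \<bar>t $ k - y $ k\<bar>)" .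
  qed
  then show False
    using t by (simp add: Omega_set_def)
qed

text \<open>This is the ratio test of the simplex method: the least ratio
  \<open>t $ k / v $ k\<close> over the support of \<open>v\<close> is the largest admissible
  multiple, and a coordinate attaining it drops to zero.\<close>

lemma nonneg_orthant_subtract_max_multiple:
  fixes t v :: "real ^ 'p"
  assumes t: "t \<in> nonneg_orthant" and v: "v \<in> nonneg_orthant"
    and supp: "pos_support v \<noteq> {}" "pos_support v \<subseteq> pos_support t"
  obtains c where "c \<ge> 0" "t - c *\<^sub>R v \<in> nonneg_orthant"
    "pos_support (t - c *\<^sub>R v) \<subset> pos_support t"
proof -
  define c where "c = Min ((\<lambda>k. t $ k / v $ k) ` pos_support v)"
  have "c \<in> (\<lambda>k. t $ k / v $ k) ` pos_support v"
    unfolding c_def using supp by (intro Min_in) auto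
  then obtain j where j: "j \<in> pos_support v" "c = t $ j / v $ j"
    by auto
  have c: "c \<ge> 0"
    using j t v by (auto simp: nonneg_orthant_def)
  have "c * v $ k \<le> t $ k" for k
  proof (cases "k \<in> pos_support v")
    case True
    then have "c \<le> t $ k / v $ k"
      unfolding c_def by (intro Min_le) auto
    then show ?thesis
      using True by (simp add: pos_support_def field_simps)
  next
    case False
    then have "v $ k = 0"
      using v by (auto simp: pos_support_def nonneg_orthant_def not_less intro: antisym)
    then show ?thesis
      using t by (simp add: nonneg_orthant_def)
  qed
  then have "t - c *\<^sub>R v \<in> nonneg_orthant"
    by (simp add: nonneg_orthant_def)
  moreover have "pos_support (t - c *\<^sub>R v) \<subset> pos_support t"
  proof
    have "0 \<le> c * v $ k" for k
      using c v by (simp add: nonneg_orthant_def)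
    then show "pos_support (t - c *\<^sub>R v) \<subseteq> pos_support t"
      by (auto simp: pos_support_def intro: le_less_trans)
    have "j \<notin> pos_support (t - c *\<^sub>R v)" "j \<in> pos_support t"
      using j supp by (auto simp: pos_support_def)
    then show "pos_support (t - c *\<^sub>R v) \<noteq> pos_support t"
      by blast
  qed
  ultimately show ?thesis
    using c that by blast
qed

lemma pos_support_nonempty:
  assumes "v \<in> std_simplex"
  shows "pos_support v \<noteq> {}"
proof
  assume "pos_support v = {}"
  then have "(\<Sum>k\<in>UNIV. v $ k) \<le> 0"
    by (intro sum_nonpos) (auto simp: pos_support_def not_less)
  then show False
    using assms by (simp add: std_simplex_def)
qed

lemma inner_nonneg_orthant:
  assumes "u \<in> nonneg_orthant" "w \<in> nonneg_orthant"
  shows "0 \<le> u \<bullet> w"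
  using assms by (auto simp: nonneg_orthant_def inner_vec_def intro!: sum_nonneg)

text \<open>The claim ranges over the whole orthant, not just the simplex, because the remainder
  after a subtraction is no longer normalized and the induction hypothesis must apply to it.\<close>

lemma quadratic_form_nonneg_of_Omega:
  fixes V :: "(real ^ 'p) set"
  assumes D: "D \<in> sym_matrices"
    and V: "finite V" "V \<noteq> {}" "V \<subseteq> std_simplex"
    and image: "\<And>v. v \<in> V \<Longrightarrow> D *v v \<in> nonneg_orthant"
    and Omega: "\<And>t. t \<in> Omega_set V \<Longrightarrow> 0 \<le> t \<bullet> (D *v t)"
    and "t \<in> nonneg_orthant"
  shows "0 \<le> t \<bullet> (D *v t)"
  using \<open>t \<in> nonneg_orthant\<close>
proof (induction "card (pos_support t)" arbitrary: t rule: less_induct)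
  case less
  define m where "m = (\<Sum>k\<in>UNIV. t $ k)"
  \<comment> \<open>Membership in \<open>Omega_set V\<close> only makes sense after scaling to the
    simplex; this keeps the support and divides the form by \<open>m\<^sup>2\<close>.\<close>
  define s where "s = (1 / m) *\<^sub>R t"
  have nonneg: "V \<subseteq> nonneg_orthant"
    using V by (auto simp: std_simplex_def)
  have "m \<ge> 0"
    using less.prems by (auto simp: m_def nonneg_orthant_def intro: sum_nonneg)
  then consider "m = 0" | "m > 0"
    by linarith
  then show ?case
  proof cases
    case 1
    then have "t = 0"
      using less.prems by (auto simp: m_def nonneg_orthant_def sum_nonneg_eq_0_iff vec_eq_iff)
    then show ?thesis
      by simp
  next
    case 2
    have s: "s \<in> std_simplex"
      using less.prems 2
      by (auto simp: s_def std_simplex_def nonneg_orthant_def simp flip: sum_divide_distrib m_def)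
    have supp: "pos_support s = pos_support t"
      using 2 by (simp add: s_def pos_support_def zero_less_divide_iff)
    show ?thesis
    proof (cases "s \<in> Omega_set V")
      case True
      have "t \<bullet> (D *v t) = m\<^sup>2 * (s \<bullet> (D *v s))"
        using 2 by (simp add: s_def matrix_vector_mult_scaleR power2_eq_square)
      then show ?thesis
        using Omega[OF True] by simp
    next
      case False
      then obtain v where v: "v \<in> V" "pos_support v \<subseteq> pos_support t"
        using pos_support_subset_of_notin_Omega[of V s] V(1,2) nonneg s supp by metis
      have v_nonneg: "v \<in> nonneg_orthant" and "pos_support v \<noteq> {}"
        using v nonneg V pos_support_nonempty by auto
      then obtain c where c: "c \<ge> 0" "t - c *\<^sub>R v \<in> nonneg_orthant"
          "pos_support (t - c *\<^sub>R v) \<subset> pos_support t"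
        using nonneg_orthant_subtract_max_multiple[of t v] less.prems v by metis
      \<comment> \<open>Expanding the form at \<open>t = r + c *\<^sub>R v\<close> leaves three
        nonnegative terms: the one in \<open>r\<close> by induction, the cross term because symmetry
        turns it into \<open>r \<bullet> (D *v v)\<close>, and the one in \<open>v\<close> because
        \<open>D *v v\<close> and \<open>v\<close> are both nonnegative.\<close>
      define r where "r = t - c *\<^sub>R v"
      have "0 \<le> r \<bullet> (D *v r)"
        unfolding r_def using c by (intro less.hyps psubset_card_mono) auto
      moreover have "0 \<le> v \<bullet> (D *v r)"
        using sym_matrices_inner_commute[OF D, of v r] inner_nonneg_orthant[OF c(2) image[OF v(1)]]
        by (simp add: r_def)
      moreover have "0 \<le> v \<bullet> (D *v v)"
        using inner_nonneg_orthant v_nonneg image v by blast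
      moreover have "t = r + c *\<^sub>R v"
        by (simp add: r_def)
      ultimately show ?thesis
        using sym_matrices_quadratic_form_add[OF D, of r c v] c by simp
    qed
  qed
qed

theorem theorem5:
  fixes A :: "real ^ 'n \<Rightarrow> real ^ 'p ^ 'p"
    and I :: "'i set"
    and \<tau> :: "'i \<Rightarrow> real ^ 'p"
  assumes "CARD('p) > 1"
    and "\<And>x. A x \<in> sym_matrices"
    and "cop_convex A"
    and "common_zeros (A ` feasible_set A) \<noteq> {}"
    and "finite I" and "I \<noteq> {}"
    and "\<And>i. i \<in> I \<Longrightarrow> \<tau> i \<in> common_zeros (A ` feasible_set A)"
  shows "feasible_set A = reduced_set A I \<tau>"
proof
  show "feasible_set A \<subseteq> reduced_set A I \<tau>"
  proof
    fix x assume x: "x \<in> feasible_set A"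
    then have cop: "A x \<in> copositive_cone"
      by (simp add: feasible_set_def)
    \<comment> \<open>Feasibility of \<open>x\<close> puts \<open>A x\<close> among the matrices
      whose forms all vanish at \<open>\<tau> i\<close>.\<close>
    have "A x *v \<tau> i \<in> nonneg_orthant" if "i \<in> I" for i
    proof (rule copositive_zero_image_nonneg[OF cop])
      show "\<tau> i \<in> nonneg_orthant" "\<tau> i \<bullet> (A x *v \<tau> i) = 0"
        using assms(7)[OF that] x by (auto simp: common_zeros_def std_simplex_def)
    qed
    moreover have "0 \<le> t \<bullet> (A x *v t)" if "t \<in> Omega_set (\<tau> ` I)" for t
      using cop that by (auto simp: copositive_cone_def Omega_set_def std_simplex_def)
    ultimately show "x \<in> reduced_set A I \<tau>"
      by (simp add: reduced_set_def)
  qed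
  show "reduced_set A I \<tau> \<subseteq> feasible_set A"
  proof
    fix x assume x: "x \<in> reduced_set A I \<tau>"
    have "0 \<le> t \<bullet> (A x *v t)" if "t \<in> nonneg_orthant" for t
    proof (rule quadratic_form_nonneg_of_Omega[where V = "\<tau> ` I"])
      show "\<tau> ` I \<subseteq> std_simplex"
        using assms(7) by (auto simp: common_zeros_def)
    qed (use assms x that in \<open>auto simp: reduced_set_def\<close>)
    then show "x \<in> feasible_set A"
      using assms(2) by (simp add: feasible_set_def copositive_cone_def)
  qed
qed

end
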